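(* For each positive integer $n$ let $\mathcal{P}_n \subset \mathbb{Z}^2$ be an $n \times n$ section of the integer lattice (a translate by an integer vector of $\{1,\dots,n\}^2$), and let $s_n \in \mathbb{R}$ be the slope of a (non-vertical) projection direction, with $\pi_n$ the one-dimensional projection of the plane along lines of slope $s_n$. Then $|\pi_n(\mathcal{P}_n)| = \Theta(n)$ if and only if the slope $s_n$ is an irreducible rational $p_n/q_n$ with $p_n, q_n = O(1)$. Explicitly, the following are equivalent: (i) there exist constants $c_1, c_2 > 0$ and $n_0$ such that $c_1 n \le |\pi_n(\mathcal{P}_n)| \le c_2 n$ for all $n \ge n_0$; (ii) there exist constants $C$ and $n_1$ such that for all $n \ge n_1$ the number $s_n$ is rational and, written in lowest terms as $s_n = p_n/q_n$ with $p_n, q_n \in \mathbb{Z}$, $q_n \ge 1$, $\gcd(p_n,q_n)=1$, satisfies $|p_n| \le C$ and $q_n \le C$.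
   Context: The one-dimensional projection of a finite point set $\mathcal{P} \subset \mathbb{R}^2$ along the direction of slope $s$ is the image of $\mathcal{P}$ under the map $(x,y) \mapsto y - s x$; equivalently, its size $|\pi(\mathcal{P})|$ is the number of distinct lines of slope $s$ containing at least one point of $\mathcal{P}$. *)

theory Defs
  imports Complex_Main
begin

text \<open>The plane is \<^typ>\<open>real \<times> real\<close>; lattice points are pairs of integers embedded in it.\<close>

definition is_lattice_section :: "nat \<Rightarrow> (real \<times> real) set \<Rightarrow> bool" where
  "is_lattice_section n P \<longleftrightarrow>
     (\<exists>a b :: int. P = {(real_of_int (a + i), real_of_int (b + j)) | i j.
                         i \<in> {1..int n} \<and> j \<in> {1..int n}})"

text \<open>Two points have the same value under the following map iff they lie on a common line of
  slope \<open>s\<close>.\<close>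

definition proj_slope :: "real \<Rightarrow> real \<times> real \<Rightarrow> real" where
  "proj_slope s = (\<lambda>(x, y). y - s * x)"

end

theory Submission
  imports Defs
begin

text \<open>
  The column of lattice points over one abscissa has pairwise different projections, so every
  projection has at least \<open>n\<close> values, and the content lies in the upper bound.

  If the slope is \<open>p / q\<close>, then \<open>q\<close> times the projection of \<open>(x, y)\<close> is the integer
  \<open>q * y - p * x\<close>; over the section these integers fill an interval of length at most
  \<open>(\<bar>p\<bar> + q) * n\<close>, so there are \<open>O(n)\<close> values when \<open>p\<close> and \<open>q\<close> are bounded.

  Conversely, suppose that there are at most \<open>c * n\<close> values and let \<open>K > c\<close> be an integer.
  A sub-box of the section with sides \<open>K\<close> and \<open>n\<close> has more points than there are values, so two
  of its points lie on a line of slope \<open>s\<close> (lemma \<open>collision_in_box\<close>). Thus \<open>s\<close> is a quotient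
  of the vertical by the horizontal distance of these two points. A box of width \<open>K\<close>
  gives a horizontal distance, hence a reduced denominator, less than \<open>K\<close>; a box of
  height \<open>K\<close> gives a vertical distance, hence a reduced numerator, less than \<open>K\<close>. The two boxes
  may yield different fractions, but passing to lowest terms only shrinks numerator and
  denominator (lemma \<open>lowest_terms_le\<close>), so both bounds apply to the same fraction.
\<close>

lemma proj_slope_lattice_section:
  assumes "is_lattice_section n P"
  obtains a b :: int where
    "proj_slope s ` P = (\<lambda>(i, j). real_of_int (b + j) - s * real_of_int (a + i)) `
       ({1..int n} \<times> {1..int n})"
proof -
  from assms obtain a b :: int where
    P: "P = {(real_of_int (a + i), real_of_int (b + j)) | i j.
               i \<in> {1..int n} \<and> j \<in> {1..int n}}"
    unfolding is_lattice_section_def by blast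
  have "P = (\<lambda>(i, j). (real_of_int (a + i), real_of_int (b + j))) `
      ({1..int n} \<times> {1..int n})"
    unfolding P by auto
  then have "proj_slope s ` P = (\<lambda>(i, j). real_of_int (b + j) - s * real_of_int (a + i)) `
      ({1..int n} \<times> {1..int n})"
    by (simp add: image_image proj_slope_def case_prod_unfold)
  then show ?thesis by (rule that)
qed

lemma card_projection_ge:
  assumes "is_lattice_section n P" "n \<ge> 1"
  shows "n \<le> card (proj_slope s ` P)"
proof -
  obtain a b :: int where
    im: "proj_slope s ` P = (\<lambda>(i, j). real_of_int (b + j) - s * real_of_int (a + i)) `
       ({1..int n} \<times> {1..int n})"
    using proj_slope_lattice_section[OF assms(1)] .
  let ?g = "\<lambda>j. real_of_int (b + j) - s * real_of_int (a + 1)"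
  have "n = card (?g ` {1..int n})"
    by (subst card_image) (auto simp: inj_on_def)
  also have "\<dots> \<le> card (proj_slope s ` P)"
    unfolding im by (rule card_mono) (use assms(2) in \<open>auto intro!: image_eqI[where x = "(1, _)"]\<close>)
  finally show ?thesis .
qed

text \<open>Clearing the denominator turns the projected values into integers from a short interval,
  placed symmetrically around the image of the translation vector \<open>(a, b)\<close>.\<close>

lemma card_projection_rational_le:
  fixes p q :: int
  assumes "is_lattice_section n P" "q \<ge> 1" "s = real_of_int p / real_of_int q"
  shows "int (card (proj_slope s ` P)) \<le> 2 * (\<bar>p\<bar> + q) * int n + 1"
proof -
  obtain a b :: int where
    im: "proj_slope s ` P = (\<lambda>(i, j). real_of_int (b + j) - s * real_of_int (a + i)) `
       ({1..int n} \<times> {1..int n})"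
    using proj_slope_lattice_section[OF assms(1)] .
  define m where "m = q * b - p * a"
  define L where "L = (\<bar>p\<bar> + q) * int n"
  have L: "L \<ge> 0" using assms(2) by (simp add: L_def)
  have "proj_slope s ` P \<subseteq> (\<lambda>k. real_of_int k / real_of_int q) ` {m - L..m + L}"
  proof
    fix v assume "v \<in> proj_slope s ` P"
    then obtain i j where ij: "i \<in> {1..int n}" "j \<in> {1..int n}"
      and v: "v = real_of_int (b + j) - s * real_of_int (a + i)"
      unfolding im by auto
    have "\<bar>q * j\<bar> \<le> q * int n" "\<bar>p * i\<bar> \<le> \<bar>p\<bar> * int n"
      using ij assms(2) by (auto simp: abs_mult intro!: mult_left_mono)
    then have "q * (b + j) - p * (a + i) \<in> {m - L..m + L}"
      by (auto simp: m_def L_def algebra_simps)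
    moreover have "v = real_of_int (q * (b + j) - p * (a + i)) / real_of_int q"
      using assms(2) by (simp add: v assms(3) field_simps)
    ultimately show "v \<in> (\<lambda>k. real_of_int k / real_of_int q) ` {m - L..m + L}"
      by blast
  qed
  then have "card (proj_slope s ` P) \<le> card {m - L..m + L}"
    by (meson card_image_le card_mono finite_atLeastAtMost_int finite_imageI le_trans)
  with L show ?thesis by (simp add: L_def algebra_simps)
qed

text \<open>The pigeonhole principle for a sub-box. Two distinct points on a line of finite slope have
  different abscissas, so the collision determines the slope.\<close>

lemma collision_in_box:
  assumes "is_lattice_section n P" "k \<le> n" "l \<le> n" "card (proj_slope s ` P) < k * l"
  obtains d e :: int where
    "d \<noteq> 0" "\<bar>d\<bar> < int k" "\<bar>e\<bar> < int l" "s * real_of_int d = real_of_int e"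
proof -
  obtain a b :: int where
    im: "proj_slope s ` P = (\<lambda>(i, j). real_of_int (b + j) - s * real_of_int (a + i)) `
       ({1..int n} \<times> {1..int n})"
    using proj_slope_lattice_section[OF assms(1)] .
  let ?f = "\<lambda>(i, j). real_of_int (b + j) - s * real_of_int (a + i)"
  let ?B = "{1..int k} \<times> {1..int l}"
  have "card (?f ` ?B) \<le> card (proj_slope s ` P)"
    unfolding im by (rule card_mono) (use assms(2,3) in \<open>auto intro!: image_mono\<close>)
  also have "\<dots> < card ?B" using assms(4) by (simp add: card_cartesian_product)
  finally have "\<not> inj_on ?f ?B" by (rule pigeonhole)
  then obtain i j i' j' where
    B: "(i, j) \<in> ?B" "(i', j') \<in> ?B" and ne: "(i, j) \<noteq> (i', j')"
    and eq: "real_of_int (b + j) - s * real_of_int (a + i) =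
             real_of_int (b + j') - s * real_of_int (a + i')"
    unfolding inj_on_def by auto
  have se: "s * real_of_int (i - i') = real_of_int (j - j')"
    using eq by (simp add: algebra_simps)
  have "i - i' \<noteq> 0" using ne se by auto
  moreover have "\<bar>i - i'\<bar> < int k" "\<bar>j - j'\<bar> < int l" using B by auto
  ultimately show ?thesis using se by (rule that)
qed

lemma lowest_terms_le:
  fixes p q d e :: int
  assumes "coprime p q" "q \<ge> 1" "s = real_of_int p / real_of_int q"
    and "d \<noteq> 0" "s * real_of_int d = real_of_int e"
  shows "q \<le> \<bar>d\<bar>" "\<bar>p\<bar> \<le> \<bar>e\<bar>"
proof -
  have "real_of_int (p * d) = real_of_int (e * q)"
    using assms(2) unfolding of_int_mult assms(5)[symmetric] assms(3) by simp
  then have eq: "p * d = e * q" by linarith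
  have "q dvd p * d" using eq by simp
  then have "q dvd d" using assms(1) by (simp add: coprime_dvd_mult_right_iff coprime_commute)
  then show "q \<le> \<bar>d\<bar>" using assms(4) by (intro zdvd_imp_le) auto
  have "p dvd e * q" using eq by (metis dvd_triv_left)
  then have "p dvd e" using assms(1) by (simp add: coprime_dvd_mult_left_iff)
  moreover have "p = 0" if "e = 0" using eq that assms(4) by simp
  ultimately show "\<bar>p\<bar> \<le> \<bar>e\<bar>" by (cases "e = 0") (auto intro: dvd_imp_le_int)
qed

text \<open>One box of width \<open>K\<close> bounds the denominator, one of height \<open>K\<close> the numerator.\<close>

lemma bounded_lowest_terms_of_few_lines:
  assumes "is_lattice_section n P" "K \<le> n" "card (proj_slope s ` P) < K * n"
  obtains p q :: int where "q \<ge> 1" "coprime p q" "s = real_of_int p / real_of_int q"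
    "\<bar>p\<bar> < int K" "q < int K"
proof -
  obtain d e :: int where
    de: "d \<noteq> 0" "\<bar>d\<bar> < int K" "s * real_of_int d = real_of_int e"
    using collision_in_box[OF assms(1,2) order_refl assms(3)] by blast
  obtain d' e' :: int where
    de': "d' \<noteq> 0" "\<bar>e'\<bar> < int K" "s * real_of_int d' = real_of_int e'"
    using collision_in_box[OF assms(1) order_refl assms(2)] assms(3)
    by (metis mult.commute)
  have "s = real_of_int e / real_of_int d" using de by (simp add: field_simps)
  then have "s \<in> \<rat>" by simp
  then obtain p q :: int where
    pq: "q > 0" "coprime p q" "s = real_of_int p / real_of_int q"
    by (rule Rats_cases') auto
  have q: "q \<ge> 1" using pq(1) by simp
  have "q < int K" using lowest_terms_le(1)[OF pq(2) q pq(3) de(1,3)] de(2) by simp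
  moreover have "\<bar>p\<bar> < int K"
    using lowest_terms_le(2)[OF pq(2) q pq(3) de'(1,3)] de'(2) by simp
  ultimately show ?thesis using that q pq(2,3) by blast
qed

theorem lemma1p5:
  fixes P :: "nat \<Rightarrow> (real \<times> real) set" and s :: "nat \<Rightarrow> real"
  assumes "\<And>n. n \<ge> 1 \<Longrightarrow> is_lattice_section n (P n)"
  shows "(\<exists>c1 c2 :: real. \<exists>n0 \<ge> 1. c1 > 0 \<and> c2 > 0 \<and>
            (\<forall>n \<ge> n0. c1 * real n \<le> real (card (proj_slope (s n) ` P n)) \<and>
                     real (card (proj_slope (s n) ` P n)) \<le> c2 * real n))
     \<longleftrightarrow> (\<exists>C :: real. \<exists>n1 \<ge> 1. \<forall>n \<ge> n1. \<exists>p q :: int.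
            q \<ge> 1 \<and> coprime p q \<and> s n = real_of_int p / real_of_int q \<and>
            real_of_int \<bar>p\<bar> \<le> C \<and> real_of_int q \<le> C)"
proof
  assume "\<exists>c1 c2 :: real. \<exists>n0 \<ge> 1. c1 > 0 \<and> c2 > 0 \<and>
            (\<forall>n \<ge> n0. c1 * real n \<le> real (card (proj_slope (s n) ` P n)) \<and>
                     real (card (proj_slope (s n) ` P n)) \<le> c2 * real n)"
  then obtain c2 :: real and n0 where n0: "n0 \<ge> 1"
    and le: "\<And>n. n \<ge> n0 \<Longrightarrow> real (card (proj_slope (s n) ` P n)) \<le> c2 * real n"
    by blast
  obtain K :: nat where K: "c2 < real K" using reals_Archimedean2 by blast
  have "\<exists>p q :: int. q \<ge> 1 \<and> coprime p q \<and> s n = real_of_int p / real_of_int q \<and>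
          real_of_int \<bar>p\<bar> \<le> real K \<and> real_of_int q \<le> real K" if n: "n \<ge> max n0 K" for n
  proof -
    have n1: "n \<ge> 1" "n \<ge> n0" "K \<le> n" using n n0 by auto
    have "c2 * real n < real K * real n" using K n1(1) by (intro mult_strict_right_mono) auto
    with le[OF n1(2)] have "real (card (proj_slope (s n) ` P n)) < real (K * n)" by simp
    then have "card (proj_slope (s n) ` P n) < K * n" by (simp only: of_nat_less_iff)
    then obtain p q :: int where "q \<ge> 1" "coprime p q"
      "s n = real_of_int p / real_of_int q" "\<bar>p\<bar> < int K" "q < int K"
      using bounded_lowest_terms_of_few_lines[OF assms[OF n1(1)] n1(3)] by blast
    moreover from this have "real_of_int \<bar>p\<bar> \<le> real K" "real_of_int q \<le> real K"
      by linarith+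
    ultimately show ?thesis by blast
  qed
  then show "\<exists>C :: real. \<exists>n1 \<ge> 1. \<forall>n \<ge> n1. \<exists>p q :: int.
            q \<ge> 1 \<and> coprime p q \<and> s n = real_of_int p / real_of_int q \<and>
            real_of_int \<bar>p\<bar> \<le> C \<and> real_of_int q \<le> C"
    using n0 by (intro exI[of _ "real K"] exI[of _ "max n0 K"]) auto
next
  assume "\<exists>C :: real. \<exists>n1 \<ge> 1. \<forall>n \<ge> n1. \<exists>p q :: int.
            q \<ge> 1 \<and> coprime p q \<and> s n = real_of_int p / real_of_int q \<and>
            real_of_int \<bar>p\<bar> \<le> C \<and> real_of_int q \<le> C"
  then obtain C :: real and n1 where n1: "n1 \<ge> 1" and
    pq: "\<And>n. n \<ge> n1 \<Longrightarrow> \<exists>p q :: int. q \<ge> 1 \<and> s n = real_of_int p / real_of_int q \<and>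
            real_of_int \<bar>p\<bar> \<le> C \<and> real_of_int q \<le> C"
    by blast
  have C: "C \<ge> 0" using pq[of n1] by force
  have "1 * real n \<le> real (card (proj_slope (s n) ` P n)) \<and>
        real (card (proj_slope (s n) ` P n)) \<le> (4 * C + 1) * real n" if n: "n \<ge> n1" for n
  proof
    have ge1: "n \<ge> 1" using n n1 by simp
    show "1 * real n \<le> real (card (proj_slope (s n) ` P n))"
      using card_projection_ge[OF assms[OF ge1] ge1] by simp
    obtain p q :: int where q: "q \<ge> 1" and s: "s n = real_of_int p / real_of_int q"
      and b: "real_of_int \<bar>p\<bar> \<le> C" "real_of_int q \<le> C"
      using pq[OF n] by blast
    have "real_of_int (int (card (proj_slope (s n) ` P n))) \<le>
        real_of_int (2 * (\<bar>p\<bar> + q) * int n + 1)"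
      using card_projection_rational_le[OF assms[OF ge1] q s] by (simp only: of_int_le_iff)
    also have "\<dots> = 2 * (real_of_int \<bar>p\<bar> + real_of_int q) * real n + 1" by simp
    also have "\<dots> \<le> (4 * C) * real n + real n"
      using b ge1 by (intro add_mono mult_right_mono) auto
    finally show "real (card (proj_slope (s n) ` P n)) \<le> (4 * C + 1) * real n"
      by (simp add: algebra_simps)
  qed
  then show "\<exists>c1 c2 :: real. \<exists>n0 \<ge> 1. c1 > 0 \<and> c2 > 0 \<and>
            (\<forall>n \<ge> n0. c1 * real n \<le> real (card (proj_slope (s n) ` P n)) \<and>
                     real (card (proj_slope (s n) ` P n)) \<le> c2 * real n)"
    using n1 C by (intro exI[of _ 1] exI[of _ "4 * C + 1"] exI[of _ n1]) auto
qed

end
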